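(* Let $\mathcal M:\mathcal X^n\to\mathcal H_{\infty,n'}(\mathcal X)$ be $(\varepsilon,\delta)$-differentially private with $(a,\beta)$-per-query accuracy, where $\beta\in(0,1/2]$. Then $$a\ge\frac12\cdot\min\Bigl\{\frac{1}{2\varepsilon}\ln\Bigl(\frac{|\mathcal X|}{16\beta n'}\Bigr)-1,\ \frac1\varepsilon\ln\Bigl(\frac{\varepsilon}{4\delta}\Bigr)-1,\ n\Bigr\}.$$
   Context: $\mathcal X$ is a finite data universe, $n,n'\in\mathbb N_+$, $\varepsilon>0$, $\delta\ge0$ (when $\delta=0$ the middle term is read as $+\infty$). A dataset is $D\in\mathcal X^n$; neighbors differ in exactly one row; $c_x(D)=|\{i:D_i=x\}|$. $\mathcal M$ is $(\varepsilon,\delta)$-differentially private if for all neighbors $D,D'$ and all sets $S$ of outputs, $\Pr[\mathcal M(D)\in S]\le e^\varepsilon\Pr[\mathcal M(D')\in S]+\delta$. $\mathcal H_{\infty,n'}(\mathcal X)$ is the set of histograms $h:\mathcal X\to\mathbb N$ with at most $n'$ nonzero values. $\mathcal M$ has $(a,\beta)$-per-query accuracy if for all $D\in\mathcal X^n$ and all $x\in\mathcal X$, $\Pr[|\mathcal M(D)_x-c_x(D)|\le a]\ge1-\beta$.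
   Formalization: The universe is assumed to have at least two elements; for |X| = 1 the claim fails, since the mechanism always returning the true constant count n is private and exact (a = 0), while for small β the bound is positive. *)

theory Defs
  imports "HOL-Probability.Probability"
begin

definition datasets :: "nat \<Rightarrow> 'x list set" where
  "datasets n = {D. length D = n}"

definition neighbors :: "nat \<Rightarrow> 'x list \<Rightarrow> 'x list \<Rightarrow> bool" where
  "neighbors n D D' \<longleftrightarrow>
     D \<in> datasets n \<and> D' \<in> datasets n \<and> card {i. i < n \<and> D ! i \<noteq> D' ! i} = 1"

definition sparse_histograms :: "nat \<Rightarrow> ('x::finite \<Rightarrow> nat) set" where
  "sparse_histograms n' = {h. card {x. h x \<noteq> 0} \<le> n'}"

text \<open>
  A randomized mechanism is a map from datasets to output distributions. Histograms over a
  finite universe form a countable set, so probability mass functions cover all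
  distributions on them. The values of a mechanism on lists of length other than n
  are never constrained.
\<close>

definition sparse_histogram_mechanism ::
    "nat \<Rightarrow> nat \<Rightarrow> ('x::finite list \<Rightarrow> ('x \<Rightarrow> nat) pmf) \<Rightarrow> bool" where
  "sparse_histogram_mechanism n n' M \<longleftrightarrow>
     (\<forall>D \<in> datasets n. set_pmf (M D) \<subseteq> sparse_histograms n')"

definition differentially_private ::
    "nat \<Rightarrow> real \<Rightarrow> real \<Rightarrow> ('x list \<Rightarrow> 'o pmf) \<Rightarrow> bool" where
  "differentially_private n \<epsilon> \<delta> M \<longleftrightarrow>
     (\<forall>D D'. neighbors n D D' \<longrightarrow>
        (\<forall>S. measure_pmf.prob (M D) S \<le> exp \<epsilon> * measure_pmf.prob (M D') S + \<delta>))"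

definition per_query_accurate ::
    "nat \<Rightarrow> real \<Rightarrow> real \<Rightarrow> ('x list \<Rightarrow> ('x \<Rightarrow> nat) pmf) \<Rightarrow> bool" where
  "per_query_accurate n a \<beta> M \<longleftrightarrow>
     (\<forall>D \<in> datasets n. \<forall>x.
        measure_pmf.prob (M D) {h. \<bar>real (h x) - real (count_list D x)\<bar> \<le> a} \<ge> 1 - \<beta>)"

end

theory Submission
  imports Defs
begin

text \<open>
  Suppose the accuracy \<open>a\<close> is too small and let \<open>m = \<lfloor>2 * a\<rfloor> + 1\<close>, so that \<open>2 * a < m \<le> n\<close>. Changing \<open>m\<close>
  rows of the constant dataset of value \<open>y\<close> to \<open>x\<close> makes the estimate of the count of \<open>x\<close> exceed
  \<open>a\<close> with probability at least \<open>1/2\<close>, so by group privacy any event containing \<open>h x > a\<close> already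
  has probability more than \<open>exp (- m * \<epsilon>) / 4\<close> on the constant dataset. For the event
  \<open>h x > a\<close> itself this probability is at most \<open>\<beta>\<close>; for the event \<open>h x \<noteq> 0\<close> it is, by sparsity and
  averaging over \<open>x\<close>, at most \<open>n' / |X|\<close> for some \<open>x\<close>. Multiplying the two bounds yields the
  geometric mean in the first term of the minimum.
\<close>

lemma count_list_replicate: "count_list (replicate k x) y = (if x = y then k else 0)"
  by (induction k) auto

text \<open>Raising \<open>k\<close> by one changes a single row, so these datasets form a path of
  neighbors starting at the constant dataset of value \<open>y\<close>; group privacy is applied
  along it.\<close>

definition two_valued :: "nat \<Rightarrow> 'x \<Rightarrow> 'x \<Rightarrow> nat \<Rightarrow> 'x list" where
  "two_valued n y x k = replicate k x @ replicate (n - k) y"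

lemma two_valued_in_datasets: "k \<le> n \<Longrightarrow> two_valued n y x k \<in> datasets n"
  by (simp add: two_valued_def datasets_def)

lemma count_list_two_valued:
  "x \<noteq> y \<Longrightarrow> count_list (two_valued n y x k) x = k"
  by (simp add: two_valued_def count_list_replicate)

lemma nth_two_valued:
  "i < n \<Longrightarrow> k \<le> n \<Longrightarrow> two_valued n y x k ! i = (if i < k then x else y)"
  by (simp add: two_valued_def nth_append)

lemma neighbors_two_valued:
  assumes "x \<noteq> y" "k < n"
  shows "neighbors n (two_valued n y x (Suc k)) (two_valued n y x k)"
proof -
  have "{i. i < n \<and> two_valued n y x (Suc k) ! i \<noteq> two_valued n y x k ! i} = {k}"
    using assms by (auto simp: nth_two_valued split: if_splits)
  thus ?thesis
    using assms by (simp add: neighbors_def two_valued_in_datasets)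
qed

text \<open>Iterating the privacy inequality sums the additive losses to a geometric series with
  denominator \<open>exp \<epsilon> - 1\<close>. The weaker denominator \<open>\<epsilon>\<close>
  still survives the induction and leads to the ratio \<open>\<epsilon> / (4 * \<delta>)\<close> of
  the theorem.\<close>

lemma group_privacy:
  fixes M :: "'x list \<Rightarrow> 'o pmf"
  assumes dp: "differentially_private n \<epsilon> \<delta> M" and "\<epsilon> > 0" "\<delta> \<ge> 0"
    and nb: "\<And>k. k < m \<Longrightarrow> neighbors n (D (Suc k)) (D k)"
  shows "measure_pmf.prob (M (D m)) S
    \<le> exp (m * \<epsilon>) * measure_pmf.prob (M (D 0)) S + \<delta> * (exp (m * \<epsilon>) - 1) / \<epsilon>"
  using nb
proof (induction m)
  case 0
  thus ?case by simp
next
  case (Suc m)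
  let ?P = "\<lambda>k. measure_pmf.prob (M (D k)) S"
  have IH: "?P m \<le> exp (m * \<epsilon>) * ?P 0 + \<delta> * (exp (m * \<epsilon>) - 1) / \<epsilon>"
    using Suc by simp
  have e: "exp (Suc m * \<epsilon>) = exp \<epsilon> * exp (m * \<epsilon>)"
    by (simp add: exp_add[symmetric] algebra_simps)
  \<comment> \<open>After cancellation, one more step of the loss recursion needs only
    \<open>1 + \<epsilon> \<le> exp \<epsilon>\<close>.\<close>
  have "\<epsilon> - exp \<epsilon> \<le> - 1"
    using exp_ge_add_one_self[of \<epsilon>] by linarith
  hence "(\<epsilon> - exp \<epsilon>) * (\<delta> / \<epsilon>) \<le> - 1 * (\<delta> / \<epsilon>)"
    using assms by (intro mult_right_mono) auto
  hence d: "exp \<epsilon> * (\<delta> * (exp (m * \<epsilon>) - 1) / \<epsilon>) + \<delta> \<le> \<delta> * (exp (Suc m * \<epsilon>) - 1) / \<epsilon>"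
    unfolding e using \<open>\<epsilon> > 0\<close> by (simp add: field_simps)
  have "?P (Suc m) \<le> exp \<epsilon> * ?P m + \<delta>"
    using dp Suc.prems[of m] by (simp add: differentially_private_def)
  also have "\<dots> \<le> exp \<epsilon> * (exp (m * \<epsilon>) * ?P 0 + \<delta> * (exp (m * \<epsilon>) - 1) / \<epsilon>) + \<delta>"
    using IH by (intro add_right_mono mult_left_mono) auto
  also have "\<dots> \<le> exp (Suc m * \<epsilon>) * ?P 0 + \<delta> * (exp (Suc m * \<epsilon>) - 1) / \<epsilon>"
    using d unfolding e by (simp add: distrib_left)
  finally show ?case .
qed

text \<open>By linearity of expectation the sum is the expected number of nonzero values, and
  sparsity bounds that number for every possible output.\<close>

lemma sum_prob_nonzero_le:
  fixes p :: "('x::finite \<Rightarrow> nat) pmf"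
  assumes "set_pmf p \<subseteq> sparse_histograms n'"
  shows "(\<Sum>x\<in>UNIV. measure_pmf.prob p {h. h x \<noteq> 0}) \<le> real n'"
proof -
  have int: "integrable (measure_pmf p) (indicator {h. h x \<noteq> 0} :: _ \<Rightarrow> real)" for x :: 'x
    by (simp add: less_top[symmetric])
  have "(\<Sum>x\<in>UNIV. measure_pmf.prob p {h. h x \<noteq> 0})
      = measure_pmf.expectation p (\<lambda>h. \<Sum>x\<in>UNIV. indicator {h. h x \<noteq> 0} h)"
    using int by (subst Bochner_Integration.integral_sum) auto
  also have "\<dots> \<le> real n'"
  proof (rule measure_pmf.integral_le_const)
    show "integrable (measure_pmf p) (\<lambda>h. \<Sum>x\<in>UNIV. indicator {h. h x \<noteq> 0} h :: real)"
      using int by (intro Bochner_Integration.integrable_sum) auto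
    show "AE h in measure_pmf p. (\<Sum>x\<in>UNIV. indicator {h. h x \<noteq> 0} h) \<le> real n'"
    proof (rule AE_pmfI)
      fix h assume "h \<in> set_pmf p"
      hence "card {x. h x \<noteq> 0} \<le> n'"
        using assms by (auto simp: sparse_histograms_def)
      moreover have "(\<Sum>x\<in>UNIV. indicator {h. h x \<noteq> 0} h) = real (card {x. h x \<noteq> 0})"
        by (simp add: indicator_def sum.If_cases)
      ultimately show "(\<Sum>x\<in>UNIV. indicator {h. h x \<noteq> 0} h) \<le> real n'"
        by simp
    qed
  qed
  finally show ?thesis .
qed

text \<open>
  The budget \<open>n' - 1/2\<close> left after removing \<open>y\<close> compensates for averaging over \<open>|X| - 1\<close>
  elements only.
\<close>

lemma exists_rarely_nonzero:
  fixes p :: "('x::finite \<Rightarrow> nat) pmf"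
  assumes "set_pmf p \<subseteq> sparse_histograms n'"
    and "measure_pmf.prob p {h. h y \<noteq> 0} \<ge> 1 / 2"
    and "CARD('x) \<ge> 2" and "2 * n' \<le> CARD('x)"
  shows "\<exists>x. x \<noteq> y \<and> measure_pmf.prob p {h. h x \<noteq> 0} \<le> real n' / real CARD('x)"
proof (rule ccontr)
  let ?q = "\<lambda>x. measure_pmf.prob p {h. h x \<noteq> 0}"
  let ?N = "real CARD('x)"
  assume "\<not> ?thesis"
  hence gt: "?q x > n' / ?N" if "x \<noteq> y" for x
    using that by force
  have card: "card (UNIV - {y}) = CARD('x) - 1"
    by (simp add: card_Diff_singleton)
  have "(\<Sum>x\<in>UNIV - {y}. n' / ?N) < (\<Sum>x\<in>UNIV - {y}. ?q x)"
  proof (rule sum_strict_mono)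
    show "UNIV - {y} \<noteq> {}"
      using card assms(3) by (metis card.empty diff_is_0_eq not_less_eq_eq numeral_2_eq_2 One_nat_def)
  qed (use gt in auto)
  also have "\<dots> = (\<Sum>x\<in>UNIV. ?q x) - ?q y"
    by (simp add: sum.remove[of UNIV y])
  also have "\<dots> \<le> n' - 1 / 2"
    using sum_prob_nonzero_le[OF assms(1)] assms(2) by linarith
  finally have "(?N - 1) * (n' / ?N) < n' - 1 / 2"
    using assms(3) by (simp add: card of_nat_diff)
  \<comment> \<open>The left side equals \<open>n' - n' / ?N\<close>, so \<open>n' / ?N\<close>
    would exceed 1/2.\<close>
  hence "?N / 2 < n'"
    using assms(3) by (simp add: field_simps)
  thus False
    using assms(4) by linarith
qed

lemma
  assumes "per_query_accurate n a \<beta> M" "D \<in> datasets n"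
  shows prob_estimate_above:
      "(\<And>h. \<bar>real (h x) - real (count_list D x)\<bar> \<le> a \<Longrightarrow> h \<in> S)
        \<Longrightarrow> measure_pmf.prob (M D) S \<ge> 1 - \<beta>"
    and prob_estimate_below:
      "(\<And>h. \<bar>real (h x) - real (count_list D x)\<bar> \<le> a \<Longrightarrow> h \<notin> S)
        \<Longrightarrow> measure_pmf.prob (M D) S \<le> \<beta>"
proof -
  have *: "measure_pmf.prob (M D) {h. \<bar>real (h x) - real (count_list D x)\<bar> \<le> a} \<ge> 1 - \<beta>"
    using assms by (simp add: per_query_accurate_def)
  have up: "measure_pmf.prob (M D) S \<ge> 1 - \<beta>"
    if "\<And>h. \<bar>real (h x) - real (count_list D x)\<bar> \<le> a \<Longrightarrow> h \<in> S" for S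
    using * measure_pmf.finite_measure_mono[of "{h. \<bar>real (h x) - real (count_list D x)\<bar> \<le> a}" S "M D"]
      that by force
  show "(\<And>h. \<bar>real (h x) - real (count_list D x)\<bar> \<le> a \<Longrightarrow> h \<in> S)
      \<Longrightarrow> measure_pmf.prob (M D) S \<ge> 1 - \<beta>"
    by (rule up)
  assume "\<And>h. \<bar>real (h x) - real (count_list D x)\<bar> \<le> a \<Longrightarrow> h \<notin> S"
  hence "measure_pmf.prob (M D) (- S) \<ge> 1 - \<beta>"
    by (intro up) auto
  thus "measure_pmf.prob (M D) S \<le> \<beta>"
    using measure_pmf.prob_compl[of S "M D"] by (simp add: Compl_eq_Diff_UNIV)
qed

theorem theorem7p2:
  fixes M :: "'x::finite list \<Rightarrow> ('x \<Rightarrow> nat) pmf"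
    and n n' :: nat
    and \<epsilon> \<delta> a \<beta> :: real
  assumes "CARD('x) \<ge> 2"
    and "n > 0" and "n' > 0"
    and "\<epsilon> > 0" and "\<delta> \<ge> 0"
    and "0 < \<beta>" and "\<beta> \<le> 1 / 2"
    and "sparse_histogram_mechanism n n' M"
    and "differentially_private n \<epsilon> \<delta> M"
    and "per_query_accurate n a \<beta> M"
  shows "ereal a \<ge> ereal (1 / 2) *
    Min {ereal (1 / (2 * \<epsilon>) * ln (real CARD('x) / (16 * \<beta> * real n')) - 1),
         (if \<delta> = 0 then \<infinity> else ereal (1 / \<epsilon> * ln (\<epsilon> / (4 * \<delta>)) - 1)),
         ereal (real n)}"
proof (rule ccontr)
  let ?N = "real CARD('x)"
  let ?A = "ereal (1 / (2 * \<epsilon>) * ln (?N / (16 * \<beta> * real n')) - 1)"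
  let ?B = "if \<delta> = 0 then \<infinity> else ereal (1 / \<epsilon> * ln (\<epsilon> / (4 * \<delta>)) - 1)"
  let ?m = "Min {?A, ?B, ereal (real n)}"
  assume "\<not> ereal a \<ge> ereal (1 / 2) * ?m"
  hence "ereal a < ereal (1 / 2) * ?m"
    by (simp only: not_le)
  hence "ereal (2 * a) < ?m"
    by (cases ?m) auto
  hence lt: "ereal (2 * a) < ?A" "ereal (2 * a) < ?B" "ereal (2 * a) < ereal (real n)"
    by (subst (asm) Min_gr_iff; simp)+
  hence a1: "2 * a + 1 < 1 / (2 * \<epsilon>) * ln (?N / (16 * \<beta> * real n'))"
    and a2: "\<delta> \<noteq> 0 \<Longrightarrow> 2 * a + 1 < 1 / \<epsilon> * ln (\<epsilon> / (4 * \<delta>))"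
    and a3: "2 * a < n"
    by auto

  \<comment> \<open>For negative \<open>a\<close> the accuracy event is empty, yet it must have
    probability at least 1/2.\<close>
  have "a \<ge> 0"
  proof (rule ccontr)
    assume "\<not> a \<ge> 0"
    hence "measure_pmf.prob (M (replicate n undefined)) {} \<ge> 1 - \<beta>"
      by (intro prob_estimate_above[OF assms(10)]) (auto simp: datasets_def)
    thus False
      using \<open>\<beta> \<le> 1 / 2\<close> by simp
  qed
  \<comment> \<open>This is the least integer strictly above \<open>2 * a\<close>. Strictness makes
    the accurate estimates for counts 0 and \<open>m\<close> disjoint; rounding up costs at most 1,
    which is the -1 in the first two terms of the minimum.\<close>
  define m where "m = nat (\<lfloor>2 * a\<rfloor> + 1)"
  have m: "2 * a < m" "m \<le> 2 * a + 1" "m \<le> n"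
    using \<open>a \<ge> 0\<close> a3 unfolding m_def by linarith+

  \<comment> \<open>The factor 4 in \<open>\<epsilon> / (4 * \<delta>)\<close> keeps the additive
    loss below 1/4, so that more than 1/4 remains of the probability
    \<open>1 - \<beta> \<ge> 1 / 2\<close>.\<close>
  have small: "\<delta> * (exp (m * \<epsilon>) - 1) / \<epsilon> < 1 / 4"
  proof (cases "\<delta> = 0")
    case False
    hence "\<delta> > 0" using assms by simp
    have "m < 1 / \<epsilon> * ln (\<epsilon> / (4 * \<delta>))"
      using a2[OF False] m by linarith
    hence "m * \<epsilon> < ln (\<epsilon> / (4 * \<delta>))"
      using \<open>\<epsilon> > 0\<close> by (simp add: field_simps)
    hence "exp (m * \<epsilon>) < \<epsilon> / (4 * \<delta>)"
      using \<open>\<epsilon> > 0\<close> \<open>\<delta> > 0\<close> by (metis exp_less_mono exp_ln divide_pos_pos mult_pos_pos zero_less_numeral)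
    hence "\<delta> * exp (m * \<epsilon>) < \<epsilon> / 4"
      using \<open>\<delta> > 0\<close> by (simp add: field_simps)
    thus ?thesis
      using \<open>\<epsilon> > 0\<close> \<open>\<delta> > 0\<close> by (simp add: field_simps)
  qed simp

  obtain y :: 'x where True by simp
  define p where "p = M (replicate n y)"
  have lower: "exp (m * \<epsilon>) * measure_pmf.prob p S > 1 / 4"
    if "x \<noteq> y" and S: "\<And>h. real (h x) > a \<Longrightarrow> h \<in> S" for x S
  proof -
    have "measure_pmf.prob (M (two_valued n y x m)) S \<ge> 1 - \<beta>"
    proof (rule prob_estimate_above[OF assms(10) two_valued_in_datasets[OF m(3)]])
      fix h :: "'x \<Rightarrow> nat"
      \<comment> \<open>The true count is \<open>m\<close>, so
        \<open>h x \<ge> m - a > a\<close>.\<close>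
      assume "\<bar>real (h x) - real (count_list (two_valued n y x m) x)\<bar> \<le> a"
      thus "h \<in> S"
        using m count_list_two_valued[OF \<open>x \<noteq> y\<close>] by (intro S) simp
    qed
    moreover have "measure_pmf.prob (M (two_valued n y x m)) S
        \<le> exp (m * \<epsilon>) * measure_pmf.prob (M (two_valued n y x 0)) S
          + \<delta> * (exp (m * \<epsilon>) - 1) / \<epsilon>"
      using m neighbors_two_valued[OF \<open>x \<noteq> y\<close>]
      by (intro group_privacy[OF assms(9)] assms) auto
    moreover have "M (two_valued n y x 0) = p"
      by (simp add: p_def two_valued_def)
    ultimately have "1 - \<beta> \<le> exp (m * \<epsilon>) * measure_pmf.prob p S + \<delta> * (exp (m * \<epsilon>) - 1) / \<epsilon>"
      by simp
    thus ?thesis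
      using small \<open>\<beta> \<le> 1 / 2\<close> by linarith
  qed
  have rep: "replicate n y \<in> datasets n"
    by (simp add: datasets_def)

  have beta: "exp (m * \<epsilon>) * \<beta> > 1 / 4" if "x \<noteq> y" for x
  proof -
    have "measure_pmf.prob p {h. real (h x) > a} \<le> \<beta>"
      unfolding p_def using that
      by (intro prob_estimate_below[OF assms(10) rep, of x]) (auto simp: count_list_replicate)
    hence "exp (m * \<epsilon>) * measure_pmf.prob p {h. real (h x) > a} \<le> exp (m * \<epsilon>) * \<beta>"
      by simp
    moreover have "1 / 4 < exp (m * \<epsilon>) * measure_pmf.prob p {h. real (h x) > a}"
      by (rule lower[OF that]) simp
    ultimately show ?thesis
      by linarith
  qed

  have "exp (m * \<epsilon>) * exp (m * \<epsilon>) * (\<beta> * n') > ?N / 16"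
  proof (cases "2 * n' \<le> CARD('x)")
    case True
    have "set_pmf p \<subseteq> sparse_histograms n'"
      using assms(8) rep by (simp add: p_def sparse_histogram_mechanism_def)
    \<comment> \<open>The estimate 0 for \<open>y\<close> would be off by \<open>n\<close>, and
      \<open>n > 2 * a \<ge> a\<close>.\<close>
    moreover have "measure_pmf.prob p {h. h y \<noteq> 0} \<ge> 1 - \<beta>"
      unfolding p_def
    proof (rule prob_estimate_above[OF assms(10) rep])
      fix h :: "'x \<Rightarrow> nat"
      assume "\<bar>real (h y) - real (count_list (replicate n y) y)\<bar> \<le> a"
      thus "h \<in> {h. h y \<noteq> 0}"
        using a3 \<open>a \<ge> 0\<close> \<open>n > 0\<close> by (cases "h y = 0") (auto simp: count_list_replicate)
    qed
    ultimately obtain x where x: "x \<noteq> y" "measure_pmf.prob p {h. h x \<noteq> 0} \<le> n' / ?N"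
      using exists_rarely_nonzero[of p n' y] True assms(1) \<open>\<beta> \<le> 1 / 2\<close> by force
    \<comment> \<open>As \<open>a \<ge> 0\<close>, the event \<open>h x \<noteq> 0\<close> contains
      \<open>h x > a\<close>, so \<open>lower\<close> applies to it.\<close>
    have "1 / 4 < exp (m * \<epsilon>) * measure_pmf.prob p {h. h x \<noteq> 0}"
      using \<open>a \<ge> 0\<close> by (intro lower[OF x(1)]) auto
    also have "\<dots> \<le> exp (m * \<epsilon>) * (n' / ?N)"
      using x by (intro mult_left_mono) auto
    finally have "1 / 4 * (1 / 4) < (exp (m * \<epsilon>) * \<beta>) * (exp (m * \<epsilon>) * (n' / ?N))"
      using beta[OF x(1)] by (intro mult_strict_mono) auto
    thus ?thesis
      by (simp add: field_simps)
  next
    case False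
    obtain x where "x \<noteq> y"
      using assms(1) by (metis card_2_iff' ex_card is_singletonI' not_numeral_le_zero UNIV_I)
    \<comment> \<open>Here \<open>n'\<close> is too large for sparsity to help. Squaring the bound
      \<open>beta\<close> and replacing one factor \<open>\<beta>\<close> by 1/2 gives 1/8; the
      missing factor \<open>?N / 2\<close> comes from \<open>n' > ?N / 2\<close>.\<close>
    have "1 / 4 * (1 / 4) < (exp (m * \<epsilon>) * \<beta>) * (exp (m * \<epsilon>) * \<beta>)"
      using beta[OF \<open>x \<noteq> y\<close>] by (intro mult_strict_mono) auto
    also have "\<dots> \<le> (exp (m * \<epsilon>) * \<beta>) * (exp (m * \<epsilon>) * (1 / 2))"
      using assms by (intro mult_left_mono) auto
    finally have "1 / 8 < exp (m * \<epsilon>) * exp (m * \<epsilon>) * \<beta>"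
      by (simp add: field_simps)
    moreover have "?N / 2 < n'"
      using False by linarith
    ultimately have "1 / 8 * (?N / 2) < (exp (m * \<epsilon>) * exp (m * \<epsilon>) * \<beta>) * n'"
      by (intro mult_strict_mono) auto
    thus ?thesis
      by (simp add: field_simps)
  qed
  hence "?N / (16 * \<beta> * n') < exp (2 * m * \<epsilon>)"
    using assms by (simp add: field_simps exp_add[symmetric])
  hence "ln (?N / (16 * \<beta> * n')) < 2 * m * \<epsilon>"
    using assms by (metis ln_exp ln_less_cancel_iff exp_gt_zero divide_pos_pos mult_pos_pos
        of_nat_0_less_iff zero_less_numeral zero_less_card_finite)
  hence "1 / (2 * \<epsilon>) * ln (?N / (16 * \<beta> * n')) < m"
    using \<open>\<epsilon> > 0\<close> by (simp add: field_simps)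
  thus False
    using a1 m by linarith
qed

end
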